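(* The function $\varphi_{Ne}(z)=1+z-\frac{z^3}{3}$ maps the open unit disk $\mathbb{D}$ onto the region bounded by the nephroid $$\left((u-1)^2+v^2-\frac{4}{9}\right)^3-\frac{4v^2}{3}=0,$$ that is, onto $\Omega_{Ne}=\left\{u+iv:\left((u-1)^2+v^2-\frac49\right)^3-\frac{4v^2}{3}<0\right\}$. This region is symmetric about the real axis and lies completely inside the right half-plane $u>0$.
   Context: $\mathbb{D}=\{z\in\mathbb{C}:|z|<1\}$; points of the plane are written $w=u+iv$ with $u,v\in\mathbb{R}$. *)

theory Defs
  imports "HOL-Complex_Analysis.Complex_Analysis"
begin

definition phi_Ne :: "complex \<Rightarrow> complex" where
  "phi_Ne z = 1 + z - z ^ 3 / 3"

definition nephroid_poly :: "real \<Rightarrow> real \<Rightarrow> real" where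
  "nephroid_poly u v = ((u - 1)\<^sup>2 + v\<^sup>2 - 4 / 9) ^ 3 - 4 * v\<^sup>2 / 3"

definition nephroid :: "complex set" where
  "nephroid = {w. nephroid_poly (Re w) (Im w) = 0}"

definition Omega_Ne :: "complex set" where
  "Omega_Ne = {w. nephroid_poly (Re w) (Im w) < 0}"

end

theory Submission
  imports Defs
begin

text \<open>With \<open>z = x + iy\<close>, \<open>R = |z|\<^sup>2\<close> and \<open>w = z - z\<^sup>3/3\<close> one has
  \<open>|w|\<^sup>2 - 4/9 = 4Ry\<^sup>2/3 - (1 - R)\<^sup>2(4 - R)/9\<close> and \<open>Im w = y(1 - R + 4y\<^sup>2/3)\<close>, so the nephroid
  polynomial is negative at \<open>1 + w\<close> for \<open>R < 1\<close> and vanishes for \<open>R = 1\<close>. Hence the image of the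
  disk is open and closed relative to the region. The region is starlike about 1, because the
  polynomial becomes negative when a point where it is nonpositive is moved towards 1;
  so it is connected and the image fills it. The same radial monotonicity identifies the region
  as the inside of the nephroid: every point beyond the curve lies on a ray that escapes to
  infinity without meeting the curve.\<close>

section \<open>Identities and estimates for \<open>phi_Ne\<close> on the closed disk\<close>

abbreviation nephroid_at :: "complex \<Rightarrow> real" where
  "nephroid_at w \<equiv> nephroid_poly (Re w) (Im w)"

lemma cube_strict_mono:
  fixes x y :: real
  assumes "x < y"
  shows "x ^ 3 < y ^ 3"
proof -
  \<comment> \<open>Twice the quadratic factor of \<open>y ^ 3 - x ^ 3\<close>, written as a sum of
    squares.\<close>
  have "0 < (x + y)\<^sup>2 + x\<^sup>2 + y\<^sup>2"
    using assms by (smt (verit) zero_le_power2 zero_less_power2)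
  then have "0 < (y - x) * ((x + y)\<^sup>2 + x\<^sup>2 + y\<^sup>2)"
    using assms by simp
  also have "\<dots> = 2 * (y ^ 3 - x ^ 3)"
    by algebra
  finally show ?thesis
    by simp
qed

lemma Re_phi_Ne: "Re (phi_Ne z) = 1 + Re z - Re z ^ 3 / 3 + Re z * (Im z)\<^sup>2"
proof -
  have "Re (z ^ 3) = Re z ^ 3 - 3 * (Re z * (Im z)\<^sup>2)"
    by (simp add: power3_eq_cube power2_eq_square algebra_simps)
  then show ?thesis
    by (simp add: phi_Ne_def diff_divide_distrib)
qed

text \<open>With the modulus in place of \<open>Re z\<close>, only the term cubic in
  \<open>Im z\<close> survives on the unit circle.\<close>

lemma Im_phi_Ne: "Im (phi_Ne z) = Im z * (1 - (cmod z)\<^sup>2 + 4 * (Im z)\<^sup>2 / 3)"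
proof -
  have "Im (z ^ 3) = 3 * (Im z * (cmod z)\<^sup>2) - 4 * (Im z * (Im z)\<^sup>2)"
    unfolding cmod_power2 by (simp add: power3_eq_cube power2_eq_square algebra_simps)
  then show ?thesis
    by (simp add: phi_Ne_def algebra_simps)
qed

lemma modulus_phi_Ne:
  "(Re (phi_Ne z) - 1)\<^sup>2 + (Im (phi_Ne z))\<^sup>2 - 4 / 9
     = 4 * (cmod z)\<^sup>2 * (Im z)\<^sup>2 / 3 - (1 - (cmod z)\<^sup>2)\<^sup>2 * (4 - (cmod z)\<^sup>2) / 9"
proof -
  have "(1 + x - x ^ 3 / 3 + x * y\<^sup>2 - 1)\<^sup>2 + (y * (1 - (x\<^sup>2 + y\<^sup>2) + 4 * y\<^sup>2 / 3))\<^sup>2 - 4 / 9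
    = 4 * (x\<^sup>2 + y\<^sup>2) * y\<^sup>2 / 3 - (1 - (x\<^sup>2 + y\<^sup>2))\<^sup>2 * (4 - (x\<^sup>2 + y\<^sup>2)) / 9" for x y :: real
    by (simp add: power2_eq_square power3_eq_cube field_simps)
  then show ?thesis
    unfolding Re_phi_Ne Im_phi_Ne cmod_power2 .
qed

lemma nephroid_at_phi_Ne_sphere:
  assumes "cmod z = 1"
  shows "nephroid_at (phi_Ne z) = 0"
  unfolding nephroid_poly_def modulus_phi_Ne unfolding Im_phi_Ne assms
  by (simp add: field_simps)

text \<open>Dropping the negative summand of \<open>modulus_phi_Ne\<close> gives strictness; the
  rest is compared with \<open>Im (phi_Ne z)\<close> using \<open>R ^ 3 \<le> 1\<close> and
  \<open>0 \<le> 1 - R\<close>.\<close>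

lemma nephroid_at_phi_Ne_ball:
  assumes "cmod z < 1"
  shows "nephroid_at (phi_Ne z) < 0"
proof -
  define R s where "R = (cmod z)\<^sup>2" and "s = (Im z)\<^sup>2"
  have R: "0 \<le> R" "R < 1" and s: "0 \<le> s"
    using assms by (simp_all add: R_def s_def power_less_one_iff)
  have "0 < (1 - R)\<^sup>2 * (4 - R) / 9"
    using R by simp
  then have "(4 * R * s / 3 - (1 - R)\<^sup>2 * (4 - R) / 9) ^ 3 < (4 * R * s / 3) ^ 3"
    by (intro cube_strict_mono) linarith
  also have "\<dots> = 4 / 3 * s * ((4 / 3 * s)\<^sup>2 * R ^ 3)"
    by algebra
  also have "\<dots> \<le> 4 / 3 * s * ((4 / 3 * s)\<^sup>2 * 1)"
    using R s by (intro mult_left_mono power_le_one) auto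
  also have "\<dots> \<le> 4 / 3 * s * (1 - R + 4 / 3 * s)\<^sup>2"
    using R s by (intro mult_left_mono) (auto intro!: power_mono)
  also have "\<dots> = 4 * (Im (phi_Ne z))\<^sup>2 / 3"
    unfolding Im_phi_Ne R_def s_def by (simp add: power_mult_distrib)
  finally show ?thesis
    unfolding nephroid_poly_def modulus_phi_Ne R_def s_def by simp
qed

text \<open>The extreme case is \<open>Re z = - a\<close> on the unit circle, which leaves a cubic
  in \<open>a\<close> to be kept below 1.\<close>

lemma Re_phi_Ne_pos:
  assumes "cmod z < 1"
  shows "0 < Re (phi_Ne z)"
proof -
  define a where "a = \<bar>Re z\<bar>"
  have "(Re z)\<^sup>2 + (Im z)\<^sup>2 \<le> 1"
    using assms by (metis cmod_power2 less_imp_le norm_ge_zero power_le_one)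
  then have y: "(Im z)\<^sup>2 \<le> 1 - a\<^sup>2" and a: "0 \<le> a"
    by (simp_all add: a_def)
  have a1: "a \<le> 1"
    using abs_Re_le_cmod [of z] assms by (simp add: a_def)
  then have "a\<^sup>2 \<le> 1"
    using a by (simp add: power_le_one)
  then have f: "0 \<le> 1 - a\<^sup>2 / 3 + (Im z)\<^sup>2"
    using zero_le_power2 [of "Im z"] by linarith
  have "Re (phi_Ne z) = 1 + Re z * (1 - a\<^sup>2 / 3 + (Im z)\<^sup>2)"
    unfolding Re_phi_Ne a_def by (simp add: power3_eq_cube power2_eq_square algebra_simps)
  moreover have "- (a * (1 - a\<^sup>2 / 3 + (Im z)\<^sup>2)) \<le> Re z * (1 - a\<^sup>2 / 3 + (Im z)\<^sup>2)"
    using mult_right_mono [OF _ f, of "- a" "Re z"] by (simp add: a_def)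
  moreover have "a * (1 - a\<^sup>2 / 3 + (Im z)\<^sup>2) \<le> a * (1 - a\<^sup>2 / 3 + (1 - a\<^sup>2))"
    using a y by (intro mult_left_mono) auto
  moreover have "a * (1 - a\<^sup>2 / 3 + (1 - a\<^sup>2)) < 1"
  proof -
    \<comment> \<open>the cubic is maximal at \<open>1 / sqrt 2\<close>, approximated here by \<open>0.71\<close>\<close>
    have "0 \<le> 4 / 3 * ((a - 71 / 100)\<^sup>2 * (a + 142 / 100))"
      using a by simp
    also have "\<dots> = 4 / 3 * a ^ 3 - 20164 / 10000 * a + 2863288 / 3000000"
      by (simp add: power3_eq_cube power2_eq_square field_simps)
    finally show ?thesis
      using a by (simp add: power3_eq_cube power2_eq_square field_simps)
  qed
  ultimately show ?thesis
    by linarith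
qed

section \<open>Shrinking towards 1 and the topology of the region\<close>

text \<open>Shrinking multiplies both \<open>m\<close> and \<open>v\<close> by \<open>q < 1\<close>.
  The cube falls strictly below \<open>q ^ 3\<close> times its old value, while the right side only
  gets the factor \<open>q \<ge> q ^ 3\<close>. Admitting equality for \<open>w\<close> covers
  points on the curve.\<close>

lemma nephroid_at_radial:
  assumes w: "nephroid_at w \<le> 0" and l: "0 \<le> l" "l < 1"
  shows "nephroid_at (1 + of_real l * (w - 1)) < 0"
proof -
  define m v q where "m = (Re w - 1)\<^sup>2 + (Im w)\<^sup>2" and "v = (Im w)\<^sup>2" and "q = l\<^sup>2"
  have q: "0 \<le> q" "q < 1" and v: "0 \<le> v" and m: "0 \<le> m"
    using l by (simp_all add: q_def v_def m_def power_less_one_iff)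
  have le: "(m - 4 / 9) ^ 3 \<le> 4 / 3 * v"
    using w by (simp add: nephroid_poly_def m_def v_def)
  have eq: "nephroid_at (1 + of_real l * (w - 1)) = (q * m - 4 / 9) ^ 3 - 4 / 3 * (q * v)"
  proof -
    have "(l * (Re w - 1))\<^sup>2 + (l * Im w)\<^sup>2 = q * m" "(l * Im w)\<^sup>2 = q * v"
      by (simp_all add: q_def m_def v_def power_mult_distrib distrib_left)
    then show ?thesis
      by (simp add: nephroid_poly_def)
  qed
  have "(q * m - 4 / 9) ^ 3 < 4 / 3 * (q * v)"
  proof (cases "q * m < 4 / 9")
    case True
    then have "(q * m - 4 / 9) ^ 3 < 0"
      by (simp add: power_less_zero_eq)
    moreover have "0 \<le> 4 / 3 * (q * v)"
      using q v by simp
    ultimately show ?thesis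
      by linarith
  next
    case False
    have "q * m - 4 / 9 < q * (m - 4 / 9)"
      using q by (simp add: algebra_simps)
    then have "(q * m - 4 / 9) ^ 3 < (q * (m - 4 / 9)) ^ 3"
      by (intro cube_strict_mono) simp
    also have "\<dots> = q ^ 3 * (m - 4 / 9) ^ 3"
      by (simp add: power_mult_distrib)
    also have "\<dots> \<le> q ^ 3 * (4 / 3 * v)"
      using le q by (intro mult_left_mono) auto
    also have "\<dots> \<le> q * (4 / 3 * v)"
      using q v power_decreasing [of 1 3 q] by (intro mult_right_mono) auto
    finally show ?thesis
      by simp
  qed
  then show ?thesis
    unfolding eq by simp
qed

lemma continuous_on_nephroid_at: "continuous_on S nephroid_at"
  unfolding nephroid_poly_def by (intro continuous_intros) auto

lemma open_Omega_Ne: "open Omega_Ne"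
  unfolding Omega_Ne_def by (intro open_Collect_less continuous_on_nephroid_at continuous_intros)

lemma one_in_Omega_Ne: "1 \<in> Omega_Ne"
  by (simp add: Omega_Ne_def nephroid_poly_def power3_eq_cube)

lemma connected_Omega_Ne: "connected Omega_Ne"
proof (rule starlike_imp_connected)
  have "(1 - t) *\<^sub>R 1 + t *\<^sub>R w \<in> Omega_Ne" if "w \<in> Omega_Ne" "0 \<le> t" "t \<le> 1" for w t
  \<comment> \<open>Strict shrinking covers every point of the segment except its end
    \<open>w\<close>.\<close>
  proof (cases "t = 1")
    case False
    then have "1 + of_real t * (w - 1) \<in> Omega_Ne"
      using that nephroid_at_radial [of w t] by (simp add: Omega_Ne_def)
    then show ?thesis
      by (simp add: scaleR_conv_of_real algebra_simps)
  qed (use that in simp)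
  then show "starlike Omega_Ne"
    unfolding starlike_def closed_segment_def using one_in_Omega_Ne by blast
qed

section \<open>The image of the disk\<close>

lemma phi_Ne_image_ball: "phi_Ne ` ball 0 1 = Omega_Ne"
proof -
  have holo: "phi_Ne holomorphic_on S" for S
    unfolding phi_Ne_def by (intro holomorphic_intros) auto
  have ball: "phi_Ne ` ball 0 1 \<subseteq> Omega_Ne"
    using nephroid_at_phi_Ne_ball by (auto simp: Omega_Ne_def)
  \<comment> \<open>Nonconstancy is what the open mapping theorem asks for.\<close>
  have "\<not> phi_Ne constant_on ball 0 1"
  proof
    assume "phi_Ne constant_on ball 0 1"
    then obtain c where "\<And>z. z \<in> ball 0 1 \<Longrightarrow> phi_Ne z = c"
      unfolding constant_on_def by blast
    from this [of 0] this [of "1 / 2"] have "phi_Ne 0 = phi_Ne (1 / 2)"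
      by (simp add: norm_divide)
    then show False
      by (simp add: phi_Ne_def power3_eq_cube)
  qed
  then have "open (phi_Ne ` ball 0 1)"
    using open_mapping_thm [OF holo, of "ball 0 1" "ball 0 1"] by auto
  then have op: "openin (top_of_set Omega_Ne) (phi_Ne ` ball 0 1)"
    using ball by (simp add: open_openin_trans open_subset)
  \<comment> \<open>The unit circle lands on the curve, hence off the region, so the compact image
    of the closed disk cuts out exactly the image of the open disk.\<close>
  have "phi_Ne ` cball 0 1 \<inter> Omega_Ne = phi_Ne ` ball 0 1"
  proof
    show "phi_Ne ` cball 0 1 \<inter> Omega_Ne \<subseteq> phi_Ne ` ball 0 1"
    proof (intro subsetI, elim IntE imageE)
      fix w z assume "w \<in> Omega_Ne" "w = phi_Ne z" "z \<in> cball 0 1"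
      then have "cmod z \<noteq> 1" "cmod z \<le> 1"
        using nephroid_at_phi_Ne_sphere [of z] by (auto simp: Omega_Ne_def)
      with \<open>w = phi_Ne z\<close> show "w \<in> phi_Ne ` ball 0 1"
        by simp
    qed
  qed (use ball in auto)
  moreover have "closed (phi_Ne ` cball 0 1)"
    by (intro compact_imp_closed compact_continuous_image holomorphic_on_imp_continuous_on holo)
       simp
  ultimately have "closedin (top_of_set Omega_Ne) (phi_Ne ` ball 0 1)"
    by (metis closedin_closed_Int inf_commute)
  with op show ?thesis
    using connected_Omega_Ne [unfolded connected_clopen, rule_format, of "phi_Ne ` ball 0 1"]
    by auto
qed

section \<open>The curve as boundary of the region\<close>

lemma bounded_Omega_Ne: "bounded Omega_Ne"
proof -
  have "compact (phi_Ne ` cball 0 1)"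
    unfolding phi_Ne_def by (intro compact_continuous_image continuous_intros) auto
  then show ?thesis
    by (metis phi_Ne_image_ball ball_subset_cball bounded_subset compact_imp_bounded image_mono)
qed

lemma frontier_Omega_Ne: "frontier Omega_Ne = nephroid"
proof
  have "closed {w. nephroid_at w \<le> 0}"
    by (intro closed_Collect_le continuous_on_nephroid_at continuous_intros)
  then have "closure Omega_Ne \<subseteq> {w. nephroid_at w \<le> 0}"
    by (rule closure_minimal [rotated]) (auto simp: Omega_Ne_def)
  then show "frontier Omega_Ne \<subseteq> nephroid"
    using open_Omega_Ne by (auto simp: frontier_def interior_open nephroid_def Omega_Ne_def)
next
  show "nephroid \<subseteq> frontier Omega_Ne"
  proof
    fix w assume w: "w \<in> nephroid"
    \<comment> \<open>These points approach \<open>w\<close> along the segment from 1, with factors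
      in [0, 1) starting at 0; so every zero of the polynomial is a limit of points of the
      region.\<close>
    define f where "f n = 1 + of_real (1 - inverse (real (Suc n))) * (w - 1)" for n
    have "(\<lambda>n. 1 - inverse (real (Suc n))) \<longlonglongrightarrow> 1 - 0"
      by (intro tendsto_diff tendsto_const LIMSEQ_inverse_real_of_nat)
    then have "f \<longlonglongrightarrow> 1 + of_real (1 - 0) * (w - 1)"
      unfolding f_def by (intro tendsto_add tendsto_mult tendsto_of_real tendsto_const)
    moreover have "f n \<in> Omega_Ne" for n
      unfolding f_def Omega_Ne_def using w nephroid_at_radial [of w "1 - inverse (real (Suc n))"]
      by (simp add: nephroid_def field_simps)
    ultimately have "w \<in> closure Omega_Ne"
      unfolding closure_sequential by auto
    with w show "w \<in> frontier Omega_Ne"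
      using open_Omega_Ne by (auto simp: frontier_def interior_open nephroid_def Omega_Ne_def)
  qed
qed

lemma inside_nephroid: "inside nephroid = Omega_Ne"
proof
  show "Omega_Ne \<subseteq> inside nephroid"
    using interior_inside_frontier [OF bounded_Omega_Ne] open_Omega_Ne
    by (simp add: interior_open frontier_Omega_Ne)
next
  have "bounded nephroid"
    using bounded_closure [OF bounded_Omega_Ne]
    by (metis Diff_subset bounded_subset frontier_Omega_Ne frontier_def)
  then have "bounded (inside nephroid)"
    by (rule bounded_inside)
  then obtain B where B: "\<And>w. w \<in> inside nephroid \<Longrightarrow> cmod w \<le> B"
    unfolding bounded_iff by blast
  show "inside nephroid \<subseteq> Omega_Ne"
  proof
    fix w assume w: "w \<in> inside nephroid"
    show "w \<in> Omega_Ne"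
    proof (rule ccontr)
      assume "w \<notin> Omega_Ne"
      moreover have "w \<notin> nephroid"
        using w inside_no_overlap by blast
      ultimately have pos: "nephroid_at w > 0"
        by (auto simp: Omega_Ne_def nephroid_def)
      \<comment> \<open>The half-line from \<open>w\<close> away from 1: if it misses the curve, it
        stays in the component of \<open>w\<close>, which must be bounded.\<close>
      define ray where "ray l = 1 + of_real l * (w - 1)" for l :: real
      have "connected (ray ` {1..})"
        unfolding ray_def by (intro connected_continuous_image continuous_intros) simp
      \<comment> \<open>Otherwise shrinking \<open>ray l\<close> by \<open>1 / l\<close> would
        return to \<open>w\<close> with a negative value.\<close>
      moreover have "nephroid_at (ray l) > 0" if "1 \<le> l" for l
      proof (rule ccontr)
        assume "\<not> nephroid_at (ray l) > 0"
        moreover have "l \<noteq> 1"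
          using calculation pos by (auto simp: ray_def)
        moreover have "1 + of_real (1 / l) * (ray l - 1) = w"
          using that by (simp add: ray_def)
        ultimately show False
          using nephroid_at_radial [of "ray l" "1 / l"] that pos by simp
      qed
      then have "ray ` {1..} \<subseteq> - nephroid"
        by (force simp: nephroid_def)
      moreover have "w \<in> ray ` {1..}"
        by (auto simp: ray_def image_iff intro!: bexI [of _ 1])
      ultimately have "ray l \<in> inside nephroid" if "1 \<le> l" for l
        using that w inside_same_component [of nephroid w "ray l"]
        unfolding connected_component_def by blast
      then have bd: "cmod (ray l) \<le> B" if "1 \<le> l" for l
        using that B by blast
      have "w \<noteq> 1"
        using \<open>w \<notin> Omega_Ne\<close> one_in_Omega_Ne by blast
      then have d: "0 < cmod (w - 1)"
        by simp
      \<comment> \<open>Of the 2, one unit pays for the centre 1 in the triangle inequality, the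
        other exceeds \<open>B\<close> strictly; the maximum keeps the point on the ray.\<close>
      define l where "l = max 1 ((B + 2) / cmod (w - 1))"
      have l: "1 \<le> l" "(B + 2) / cmod (w - 1) \<le> l"
        by (simp_all add: l_def)
      have "B + 2 \<le> l * cmod (w - 1)"
        using l d by (simp add: divide_le_eq)
      also have "\<dots> = cmod (ray l - 1)"
        using l by (simp add: ray_def norm_mult)
      also have "\<dots> \<le> cmod (ray l) + 1"
        using norm_triangle_ineq4 [of "ray l" 1] by simp
      finally show False
        using bd [OF l(1)] by simp
    qed
  qed
qed

lemma cnj_image_Omega_Ne: "cnj ` Omega_Ne = Omega_Ne"
proof -
  have "cnj w \<in> Omega_Ne \<longleftrightarrow> w \<in> Omega_Ne" for w
    by (simp add: Omega_Ne_def nephroid_poly_def)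
  then show ?thesis
    by (metis (no_types, lifting) complex_cnj_cnj image_iff subsetI subset_antisym)
qed

text \<open>Being bounded by the curve is expressed through both \<open>inside\<close> and
  \<open>frontier\<close>.\<close>

theorem theorem1p1:
  "phi_Ne ` ball 0 1 = Omega_Ne
   \<and> Omega_Ne = inside nephroid \<and> frontier Omega_Ne = nephroid
   \<and> cnj ` Omega_Ne = Omega_Ne
   \<and> Omega_Ne \<subseteq> {w. Re w > 0}"
proof -
  \<comment> \<open>The half-plane bound is read off from the parametrization by the disk.\<close>
  have "Omega_Ne \<subseteq> {w. Re w > 0}"
    unfolding phi_Ne_image_ball [symmetric] using Re_phi_Ne_pos by auto
  then show ?thesis
    by (simp add: phi_Ne_image_ball inside_nephroid frontier_Omega_Ne cnj_image_Omega_Ne)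
qed

end
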